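(* Let $X$ be a Banach space, $(A_n)_{n\in\mathbb{N}}\subset B(X)$, $D\geqslant 1$, $\varepsilon\geqslant 0$ and $a,b\in\mathbb{R}$. Suppose that the equation $x_{m+1}=A_mx_m$, $m\in\mathbb{N}$, admits a general dichotomy with bounds $$a_{m,n}=D\,e^{a(m-n)+\varepsilon n}\ \ ((m,n)\in\mathbb{N}^2_{\geqslant})\qquad\text{and}\qquad b_{m,n}=D\,e^{b(m-n)+\varepsilon n}\ \ ((m,n)\in\mathbb{N}^2_{\leqslant}).$$ Let $B_n:X\to X$, $n\in\mathbb{N}$, be bounded linear operators such that $\|B_n\|\leqslant\delta e^{-\gamma(n+1)}$ for all $n\in\mathbb{N}$, for some $\delta>0$ and some $\gamma\in\mathbb{R}$. If $$a\leqslant b,\qquad \varepsilon-\gamma<0\qquad\text{and}\qquad \theta:=D\delta e^{2\varepsilon-2\gamma-a}\left(1-e^{\varepsilon-\gamma}\right)^{-1}<1,$$ then the equation $x_{m+1}=(A_m+B_m)x_m$, $m\in\mathbb{N}$, admits a general dichotomy with bounds $\frac{D}{1-\theta}e^{a(m-n)+\varepsilon n}$ (for $(m,n)\in\mathbb{N}^2_{\geqslant}$) and $\frac{D}{1-\theta}e^{b(m-n)+\varepsilon n}$ (for $(m,n)\in\mathbb{N}^2_{\leqslant}$).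
   Context: $\mathbb{N}=\{1,2,3,\dots\}$; $B(X)$ is the space of bounded linear operators on the Banach space $X$. $\mathbb{N}^2_{\geqslant}=\{(m,n)\in\mathbb{N}^2: m\geqslant n\}$ and $\mathbb{N}^2_{\leqslant}=\{(m,n)\in\mathbb{N}^2: m\leqslant n\}$. For $(A_n)_{n\in\mathbb{N}}\subset B(X)$ and $m\geqslant n$, put $\mathcal{A}_{m,n}=A_{m-1}\cdots A_n$ if $m>n$ and $\mathcal{A}_{n,n}=\mathrm{Id}$. The equation $x_{m+1}=A_mx_m$, $m\in\mathbb{N}$, admits an invariant splitting if there are bounded projections $P_n\in B(X)$, $n\in\mathbb{N}$, such that for every $(m,n)\in\mathbb{N}^2_{\geqslant}$: (S1) $P_m\mathcal{A}_{m,n}=\mathcal{A}_{m,n}P_n$; (S2) $\mathcal{A}_{m,n}(\ker P_n)=\ker P_m$; (S3) $\mathcal{A}_{m,n}|_{\ker P_n}:\ker P_n\to\ker P_m$ is invertible (with bounded inverse). In that case, for $m\geqslant n$, $\mathcal{A}_{n,m}:\ker P_m\to\ker P_n$ denotes the inverse of $\mathcal{A}_{m,n}|_{\ker P_n}$, and $Q_n=\mathrm{Id}-P_n$. The equation admits a general dichotomy with bounds $(a_{m,n})_{(m,n)\in\mathbb{N}^2_{\geqslant}}$ and $(b_{m,n})_{(m,n)\in\mathbb{N}^2_{\leqslant}}$ if it admits an invariant splitting such that (D1) $\|\mathcal{A}_{m,n}P_n\|\leqslant a_{m,n}$ for all $(m,n)\in\mathbb{N}^2_{\geqslant}$ and (D2)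 $\|\mathcal{A}_{m,n}Q_n\|\leqslant b_{m,n}$ for all $(m,n)\in\mathbb{N}^2_{\leqslant}$. *)

theory Defs
  imports "HOL-Analysis.Analysis"
begin

text \<open>
  The index set is \<open>{1,2,3,\<dots>}\<close>, so the sequences below only matter at indices \<open>n \<ge> 1\<close>;
  every condition carries this bound explicitly.
\<close>

definition idx_ge :: "(nat \<times> nat) set" where
  "idx_ge = {(m, n). 1 \<le> n \<and> n \<le> m}"

definition idx_le :: "(nat \<times> nat) set" where
  "idx_le = {(m, n). 1 \<le> m \<and> m \<le> n}"

text \<open>
  \<open>evol A m n\<close> is \<open>A (m - 1) \<cdots> A n\<close> for \<open>m > n\<close> and the identity for \<open>m = n\<close>.
  For \<open>m < n\<close> the value is a dummy that is never used: there the evolution is only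
  defined on kernels, by \<open>evol_back\<close>.
\<close>

primrec evol :: "(nat \<Rightarrow> 'a::real_normed_vector \<Rightarrow>\<^sub>L 'a) \<Rightarrow> nat \<Rightarrow> nat \<Rightarrow> 'a \<Rightarrow>\<^sub>L 'a" where
  "evol A 0 n = id_blinfun"
| "evol A (Suc m) n = (if n \<le> m then A m o\<^sub>L evol A m n else id_blinfun)"

definition blinfun_ker :: "('a::real_normed_vector \<Rightarrow>\<^sub>L 'b::real_normed_vector) \<Rightarrow> 'a set" where
  "blinfun_ker T = {x. blinfun_apply T x = 0}"

text \<open>
  For \<open>m \<le> n\<close>, \<open>evol_back A P m n\<close> is the inverse \<open>ker (P n) \<rightarrow> ker (P m)\<close> of the restriction of
  \<open>evol A n m\<close> to \<open>ker (P m)\<close>; it is meaningful only on \<open>ker (P n)\<close>.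
\<close>

definition evol_back ::
  "(nat \<Rightarrow> 'a::real_normed_vector \<Rightarrow>\<^sub>L 'a) \<Rightarrow> (nat \<Rightarrow> 'a \<Rightarrow>\<^sub>L 'a) \<Rightarrow> nat \<Rightarrow> nat \<Rightarrow> 'a \<Rightarrow> 'a" where
  "evol_back A P m n = inv_into (blinfun_ker (P m)) (blinfun_apply (evol A n m))"

text \<open>
  The inverse of a linear bijection between the kernels is automatically linear, so its
  boundedness is expressed by the norm estimate on \<open>ker (P m)\<close>.
\<close>

definition invariant_splitting ::
  "(nat \<Rightarrow> 'a::real_normed_vector \<Rightarrow>\<^sub>L 'a) \<Rightarrow> (nat \<Rightarrow> 'a \<Rightarrow>\<^sub>L 'a) \<Rightarrow> bool" where
  "invariant_splitting A P \<longleftrightarrow>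
     (\<forall>n\<ge>1. P n o\<^sub>L P n = P n) \<and>
     (\<forall>(m, n)\<in>idx_ge.
        P m o\<^sub>L evol A m n = evol A m n o\<^sub>L P n \<and>
        blinfun_apply (evol A m n) ` blinfun_ker (P n) = blinfun_ker (P m) \<and>
        bij_betw (blinfun_apply (evol A m n)) (blinfun_ker (P n)) (blinfun_ker (P m)) \<and>
        (\<exists>K. \<forall>y\<in>blinfun_ker (P m). norm (evol_back A P n m y) \<le> K * norm y))"

text \<open>
  In the second estimate \<open>onorm\<close> is the operator norm of the map \<open>evol_back A P m n \<circ> Q n\<close> with
  \<open>Q n = id - P n\<close>, which is bounded and linear on the whole space because \<open>P\<close> is an
  invariant splitting.
\<close>

definition general_dichotomy ::
  "(nat \<Rightarrow> 'a::real_normed_vector \<Rightarrow>\<^sub>L 'a) \<Rightarrow> (nat \<Rightarrow> nat \<Rightarrow> real) \<Rightarrow> (nat \<Rightarrow> nat \<Rightarrow> real) \<Rightarrow> bool" where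
  "general_dichotomy A a b \<longleftrightarrow>
     (\<exists>P. invariant_splitting A P \<and>
        (\<forall>(m, n)\<in>idx_ge. norm (evol A m n o\<^sub>L P n) \<le> a m n) \<and>
        (\<forall>(m, n)\<in>idx_le.
           onorm (evol_back A P m n \<circ> blinfun_apply (id_blinfun - P n)) \<le> b m n))"

end

theory Submission imports Defs
begin

text \<open>
  An invariant splitting is the same thing as a Green kernel: put \<open>G m n = \<A>\<^sub>m\<^sub>,\<^sub>n P\<^sub>n\<close> for
  \<open>m \<ge> n\<close> and \<open>G m n = - \<A>\<^sub>m\<^sub>,\<^sub>n Q\<^sub>n\<close> for \<open>m < n\<close>. The kernel of the perturbed equation
  is the fixed point \<open>H m n = G m n + (\<Sum>k. G m (k + 1) B\<^sub>k H k n)\<close>. With \<open>r t = min (a t) (b t)\<close>,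
  both dichotomy bounds read \<open>D exp (r (m - n) + \<epsilon> n)\<close>; since \<open>r\<close> is superadditive, the sum is
  a \<open>\<theta>\<close>-contraction for the weight \<open>exp (r (m - n))\<close>, which yields \<open>H\<close> with both bounds at once.
  The sum is also a \<open>\<theta>\<close>-contraction for the weight \<open>exp (a m)\<close>, which up to a factor
  depending on \<open>n\<close> dominates all the previous ones, so that fixed points are unique; hence \<open>H m n H n n\<close> is \<open>H m n\<close> or \<open>0\<close>, and
  \<open>H m (n + 1) (A\<^sub>n + B\<^sub>n) = H m n\<close> for \<open>m \<noteq> n\<close>, and so \<open>H\<close> is again a Green kernel.
\<close>

section \<open>Algebra of operator composition\<close>

lemmas blinfun_compose_simps =
  bounded_bilinear.add_left[OF bounded_bilinear_blinfun_compose]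
  bounded_bilinear.add_right[OF bounded_bilinear_blinfun_compose]
  bounded_bilinear.diff_left[OF bounded_bilinear_blinfun_compose]
  bounded_bilinear.diff_right[OF bounded_bilinear_blinfun_compose]
  bounded_bilinear.minus_left[OF bounded_bilinear_blinfun_compose]
  bounded_bilinear.minus_right[OF bounded_bilinear_blinfun_compose]

lemma blinfun_compose_assoc: "(S o\<^sub>L T) o\<^sub>L U = S o\<^sub>L (T o\<^sub>L U)"
  by (rule blinfun_eqI) simp

lemma id_blinfun_compose [simp]: "id_blinfun o\<^sub>L T = T" "T o\<^sub>L id_blinfun = T"
  by (auto intro: blinfun_eqI)

section \<open>Contractive kernel operators in weighted sup norms\<close>

text \<open>Since \<open>c k\<close> in \<open>K_le\<close> does not depend on \<open>m\<close>,
  summing over \<open>k\<close> makes the operator with kernel \<open>K\<close> a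
  \<theta>-contraction for the supremum of \<open>norm (x m) / w m\<close>. The unknowns are
  sequences of operators, so that a whole column of a Green kernel is solved for at once.\<close>

locale weighted_kernel =
  fixes K :: "nat \<Rightarrow> nat \<Rightarrow> 'a::banach \<Rightarrow>\<^sub>L 'a" and w c :: "nat \<Rightarrow> real" and \<theta> :: real
  assumes w_pos: "w m > 0"
    and c_sums: "c sums \<theta>"
    and \<theta>_less: "\<theta> < 1"
    and K_le: "norm (K m k) * w k \<le> c k * w m"
begin

lemma c_nonneg: "c k \<ge> 0"
proof -
  have "0 \<le> c k * w k"
    using K_le[of k k] w_pos[of k] by (smt (verit) mult_nonneg_nonneg norm_ge_zero)
  then show ?thesis
    using w_pos[of k] by (simp add: zero_le_mult_iff)
qed

lemma \<theta>_nonneg: "\<theta> \<ge> 0"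
  using c_sums c_nonneg by (metis sums_le sums_zero)

definition bounded_by :: "real \<Rightarrow> (nat \<Rightarrow> 'a \<Rightarrow>\<^sub>L 'a) \<Rightarrow> bool" where
  "bounded_by C x \<longleftrightarrow> (\<forall>m. norm (x m) \<le> C * w m)"

definition kernel_op :: "(nat \<Rightarrow> 'a \<Rightarrow>\<^sub>L 'a) \<Rightarrow> nat \<Rightarrow> 'a \<Rightarrow>\<^sub>L 'a" where
  "kernel_op x m = (\<Sum>k. K m k o\<^sub>L x k)"

lemma bounded_by_nonneg: "bounded_by C x \<Longrightarrow> C \<ge> 0"
  unfolding bounded_by_def using w_pos[of 0]
  by (metis norm_ge_zero order_trans zero_le_mult_iff not_le less_imp_le mult_less_0_iff)

lemma bounded_by_diff: "bounded_by C x \<Longrightarrow> bounded_by C' y \<Longrightarrow> bounded_by (C + C') (\<lambda>m. x m - y m)"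
  unfolding bounded_by_def by (simp add: distrib_right) (meson add_mono norm_triangle_ineq4 order_trans)

lemma norm_term_le:
  assumes "bounded_by C x"
  shows "norm (K m k o\<^sub>L x k) \<le> c k * (C * w m)"
proof -
  have "norm (K m k o\<^sub>L x k) \<le> norm (K m k) * norm (x k)"
    by (rule norm_blinfun_compose)
  also have "\<dots> \<le> norm (K m k) * (C * w k)"
    using assms by (intro mult_left_mono) (auto simp: bounded_by_def)
  also have "\<dots> = C * (norm (K m k) * w k)"
    by simp
  also have "\<dots> \<le> C * (c k * w m)"
    by (rule mult_left_mono[OF K_le bounded_by_nonneg[OF assms]])
  finally show ?thesis by (simp add: mult_ac)
qed

lemma summable_term:
  assumes "bounded_by C x"
  shows "summable (\<lambda>k. K m k o\<^sub>L x k)"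
  by (rule summable_comparison_test'[where N = 0, OF summable_mult2 norm_term_le[OF assms]])
     (use c_sums in \<open>simp add: sums_iff\<close>)

lemma bounded_by_kernel_op:
  assumes "bounded_by C x"
  shows "bounded_by (\<theta> * C) (kernel_op x)"
  unfolding bounded_by_def
proof
  fix m
  have s: "(\<lambda>k. c k * (C * w m)) sums (\<theta> * (C * w m))"
    by (rule sums_mult2[OF c_sums])
  then have "norm (kernel_op x m) \<le> (\<Sum>k. c k * (C * w m))"
    unfolding kernel_op_def
    by (intro norm_suminf_le) (auto simp: sums_iff norm_term_le[OF assms])
  with s show "norm (kernel_op x m) \<le> \<theta> * C * w m"
    by (simp add: sums_iff mult_ac)
qed

lemma kernel_op_diff:
  assumes "bounded_by C x" "bounded_by C' y"
  shows "kernel_op (\<lambda>m. x m - y m) m = kernel_op x m - kernel_op y m"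
  unfolding kernel_op_def
  using suminf_diff[OF summable_term[OF assms(1), of m] summable_term[OF assms(2), of m]]
  by (simp add: blinfun_compose_simps)

text \<open>The difference is a fixed point of a linear operator, so its bound improves by a factor
  \<theta> with each application and tends to 0. The two constants may differ.\<close>

lemma kernel_op_unique:
  assumes x: "bounded_by C x" "\<And>m. x m = f m + kernel_op x m"
    and y: "bounded_by C' y" "\<And>m. y m = f m + kernel_op y m"
  shows "x m = y m"
proof -
  let ?d = "\<lambda>m. x m - y m"
  have d: "kernel_op ?d = ?d"
  proof
    fix m show "kernel_op ?d m = ?d m"
      using x(2)[of m] y(2)[of m] kernel_op_diff[OF x(1) y(1), of m] by (metis add_diff_cancel_left)
  qed
  have "bounded_by (\<theta> ^ j * (C + C')) ?d" for j
  proof (induction j)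
    case 0
    then show ?case using bounded_by_diff[OF x(1) y(1)] by simp
  next
    case (Suc j)
    from bounded_by_kernel_op[OF Suc] show ?case by (simp add: d mult_ac)
  qed
  then have le: "norm (?d m) \<le> \<theta> ^ j * ((C + C') * w m)" for j
    by (auto simp: bounded_by_def mult_ac)
  have "(\<lambda>j. \<theta> ^ j * ((C + C') * w m)) \<longlonglongrightarrow> 0"
    by (intro tendsto_mult_left_zero LIMSEQ_realpow_zero \<theta>_nonneg \<theta>_less)
  then have "norm (?d m) \<le> 0"
    by (rule LIMSEQ_le_const) (use le in blast)
  then show ?thesis by simp
qed

text \<open>Picard iteration from 0: the successive differences are bounded by
  \<open>\<theta> ^ N * C\<close>, completeness sums them, and the geometric series yields the
  constant \<open>C / (1 - \<theta>)\<close>.\<close>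

lemma kernel_op_fixpoint:
  assumes f: "bounded_by C f"
  obtains x where "bounded_by (C / (1 - \<theta>)) x" "\<And>m. x m = f m + kernel_op x m"
proof -
  define X where "X N = ((\<lambda>x m. f m + kernel_op x m) ^^ N) (\<lambda>_. 0)" for N
  have X_Suc: "X (Suc N) = (\<lambda>m. f m + kernel_op (X N) m)" for N
    by (simp add: X_def)
  have C: "C \<ge> 0"
    by (rule bounded_by_nonneg[OF f])
  have X_bounded: "\<exists>L. bounded_by L (X N)" for N
  proof (induction N)
    case 0
    show ?case using C w_pos by (intro exI[of _ 0]) (simp add: X_def bounded_by_def)
  next
    case (Suc N)
    then obtain L where "bounded_by L (X N)" ..
    from bounded_by_kernel_op[OF this] f have "bounded_by (C + \<theta> * L) (X (Suc N))"
      by (auto simp: bounded_by_def X_Suc distrib_right intro!: norm_triangle_mono)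
    then show ?case ..
  qed
  let ?d = "\<lambda>N m. X (Suc N) m - X N m"
  have d_Suc: "?d (Suc N) = kernel_op (?d N)" for N
  proof
    fix m
    obtain L L' where "bounded_by L (X (Suc N))" "bounded_by L' (X N)"
      using X_bounded by blast
    from kernel_op_diff[OF this, of m] show "?d (Suc N) m = kernel_op (?d N) m"
      by (simp add: X_Suc)
  qed
  have "bounded_by (\<theta> ^ N * C) (?d N)" for N
  proof (induction N)
    case 0
    have "bounded_by (0 + \<theta> * 0) (kernel_op (X 0))"
      using bounded_by_kernel_op[of 0 "X 0"] by (simp add: X_def bounded_by_def)
    then have "kernel_op (X 0) m = 0" for m
      by (simp add: bounded_by_def)
    with f show ?case
      unfolding X_Suc by (simp add: X_def)
  next
    case (Suc N)
    show ?case
      unfolding d_Suc using bounded_by_kernel_op[OF Suc.IH] by (simp only: power_Suc mult_ac)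
  qed
  then have d_le: "norm (?d N m) \<le> \<theta> ^ N * (C * w m)" for N m
    by (auto simp: bounded_by_def mult_ac)
  have tail_sums: "(\<lambda>i. \<theta> ^ (i + N) * (C * w m)) sums (\<theta> ^ N * (C / (1 - \<theta>)) * w m)" for N m
    using sums_mult2[OF geometric_sums[of \<theta>], of "\<theta> ^ N * (C * w m)"] \<theta>_nonneg \<theta>_less
    by (simp add: power_add mult_ac)
  have d_summable: "summable (\<lambda>N. ?d N m)" for m
  proof (rule summable_comparison_test')
    show "summable (\<lambda>N. \<theta> ^ N * (C * w m))"
      using sums_summable[OF tail_sums[of 0 m]] by simp
  qed (rule d_le)
  define x where "x m = (\<Sum>N. ?d N m)" for m
  \<comment> \<open>The tail of the telescoping series measures the distance from \<open>x\<close>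
    to the iterate \<open>X N\<close>: \<open>N = 0\<close> gives the bound on \<open>x\<close>,
    large \<open>N\<close> the passage to the limit.\<close>
  have rest: "bounded_by (\<theta> ^ N * (C / (1 - \<theta>))) (\<lambda>m. x m - X N m)" for N
    unfolding bounded_by_def
  proof
    fix m
    have "(\<Sum>i<N. ?d i m) = X N m"
      using sum_lessThan_telescope[of "\<lambda>i. X i m" N] by (simp add: X_def)
    then have "x m - X N m = (\<Sum>i. ?d (i + N) m)"
      using suminf_split_initial_segment[OF d_summable, of m N] by (simp add: x_def)
    also have "norm \<dots> \<le> (\<Sum>i. \<theta> ^ (i + N) * (C * w m))"
      by (rule norm_suminf_le[OF d_le sums_summable[OF tail_sums]])
    also have "\<dots> = \<theta> ^ N * (C / (1 - \<theta>)) * w m"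
      by (rule sums_unique[OF tail_sums, symmetric])
    finally show "norm (x m - X N m) \<le> \<theta> ^ N * (C / (1 - \<theta>)) * w m" .
  qed
  have x_bounded: "bounded_by (C / (1 - \<theta>)) x"
    using rest[of 0] by (simp add: X_def)
  have "x m = f m + kernel_op x m" for m
  proof -
    \<comment> \<open>In place of continuity of \<open>kernel_op\<close>: the defect of
      \<open>x\<close> splits into the error of \<open>X (Suc N)\<close> and the image of the error
      of \<open>X N\<close>, each at most a constant times \<open>\<theta> ^ N\<close>.\<close>
    have "norm (x m - (f m + kernel_op x m)) \<le> \<theta> ^ N * (2 * \<theta> * (C / (1 - \<theta>)) * w m)" for N
    proof -
      obtain L where L: "bounded_by L (X N)"
        using X_bounded by blast
      have "x m - (f m + kernel_op x m) = (x m - X (Suc N) m) - kernel_op (\<lambda>m. x m - X N m) m"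
        by (simp add: X_Suc kernel_op_diff[OF x_bounded L])
      also have "norm \<dots> \<le> norm (x m - X (Suc N) m) + norm (kernel_op (\<lambda>m. x m - X N m) m)"
        by (rule norm_triangle_ineq4)
      also have "\<dots> \<le> \<theta> ^ Suc N * (C / (1 - \<theta>)) * w m + \<theta> * (\<theta> ^ N * (C / (1 - \<theta>))) * w m"
        using rest[of "Suc N"] bounded_by_kernel_op[OF rest[of N]]
        by (intro add_mono) (simp_all only: bounded_by_def)
      also have "\<dots> = \<theta> ^ N * (2 * \<theta> * (C / (1 - \<theta>)) * w m)"
        by (simp add: algebra_simps)
      finally show ?thesis .
    qed
    moreover have "(\<lambda>N. \<theta> ^ N * (2 * \<theta> * (C / (1 - \<theta>)) * w m)) \<longlonglongrightarrow> 0"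
      by (intro tendsto_mult_left_zero LIMSEQ_realpow_zero \<theta>_nonneg \<theta>_less)
    ultimately have "norm (x m - (f m + kernel_op x m)) \<le> 0"
      by (intro LIMSEQ_le_const) blast+
    then show ?thesis by simp
  qed
  with x_bounded show thesis by (rule that)
qed

lemma kernel_op_sums:
  assumes "bounded_by C x"
  shows "(\<lambda>k. K m k o\<^sub>L x k) sums kernel_op x m"
  unfolding kernel_op_def by (rule summable_sums[OF summable_term[OF assms]])

lemma bounded_by_compose:
  assumes "bounded_by C x"
  shows "bounded_by (C * norm S) (\<lambda>m. x m o\<^sub>L S)"
  unfolding bounded_by_def
proof
  fix m
  have "norm (x m o\<^sub>L S) \<le> norm (x m) * norm S"
    by (rule norm_blinfun_compose)
  also have "\<dots> \<le> C * w m * norm S"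
    using assms by (intro mult_right_mono) (auto simp: bounded_by_def)
  finally show "norm (x m o\<^sub>L S) \<le> C * norm S * w m"
    by (simp add: mult_ac)
qed

text \<open>Serves the idempotence argument, which compares a column of the perturbed kernel with
  its restriction to the indices from the diagonal on.\<close>

lemma bounded_by_truncate:
  assumes "bounded_by C x"
  shows "bounded_by C (\<lambda>m. if Q m then x m else 0)"
  using assms bounded_by_nonneg[OF assms] w_pos by (auto simp: bounded_by_def less_imp_le)

lemma kernel_op_compose:
  assumes "bounded_by C x"
  shows "kernel_op (\<lambda>m. x m o\<^sub>L S) m = kernel_op x m o\<^sub>L S"
proof -
  have "(\<lambda>k. (K m k o\<^sub>L x k) o\<^sub>L S) sums (kernel_op x m o\<^sub>L S)"
    by (rule bounded_linear.sums[OF bounded_bilinear.bounded_linear_left[OF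
          bounded_bilinear_blinfun_compose] kernel_op_sums[OF assms]])
  then show ?thesis
    by (simp add: blinfun_compose_assoc kernel_op_def sums_iff)
qed

text \<open>The spike models the jump of a Green kernel on its diagonal, which has to be removed
  before columns \<open>n\<close> and \<open>Suc n\<close> can be compared.\<close>

lemma bounded_by_single: "bounded_by (norm S / w n) (\<lambda>k. if k = n then S else 0)"
  using w_pos by (simp add: bounded_by_def less_imp_le less_imp_neq[OF w_pos, symmetric])

lemma kernel_op_single: "kernel_op (\<lambda>k. if k = n then S else 0) m = K m n o\<^sub>L S"
proof -
  have "(\<lambda>k. K m k o\<^sub>L (if k = n then S else 0)) = (\<lambda>k. if k = n then K m k o\<^sub>L S else 0)"
    by auto
  then show ?thesis
    using sums_single[of n "\<lambda>k. K m k o\<^sub>L S"] by (simp add: kernel_op_def sums_iff)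
qed

end

section \<open>Green kernels and their composition law\<close>

text \<open>
  Green kernels are indexed from \<open>0\<close>: a dichotomy of \<open>A\<close> corresponds to a Green kernel of the
  shifted sequence \<open>\<lambda>n. A (Suc n)\<close>.
\<close>

definition green ::
  "(nat \<Rightarrow> 'a::real_normed_vector \<Rightarrow>\<^sub>L 'a) \<Rightarrow> (nat \<Rightarrow> nat \<Rightarrow> 'a \<Rightarrow>\<^sub>L 'a) \<Rightarrow> bool" where
  "green A G \<longleftrightarrow>
     (\<forall>m n. G (Suc m) n = (A m o\<^sub>L G m n) + (if Suc m = n then id_blinfun else 0)) \<and>
     (\<forall>m n. G m n = (G m (Suc n) o\<^sub>L A n) + (if m = n then id_blinfun else 0)) \<and>
     (\<forall>m n. G m n o\<^sub>L G n n = (if n \<le> m then G m n else 0))"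

lemma evol_self [simp]: "evol A n n = id_blinfun"
  by (cases n) auto

lemma evol_step_right: "n < m \<Longrightarrow> evol A m n = evol A m (Suc n) o\<^sub>L A n"
proof (induction m)
  case (Suc m)
  then show ?case
    by (cases "n = m") (auto simp: blinfun_compose_assoc)
qed simp

lemma evol_trans: "n \<le> k \<Longrightarrow> k \<le> m \<Longrightarrow> evol A m n = evol A m k o\<^sub>L evol A k n"
proof (induction m)
  case (Suc m)
  show ?case
  proof (cases "k = Suc m")
    case False
    then have "k \<le> m" "n \<le> m"
      using Suc.prems by auto
    then show ?thesis
      using Suc.IH[OF Suc.prems(1)] by (simp add: blinfun_compose_assoc)
  qed simp
qed simp

lemma evol_shift: "evol (\<lambda>n. A (Suc n)) m n = evol A (Suc m) (Suc n)"
  by (induction m) auto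

context
  fixes A :: "nat \<Rightarrow> 'a::real_normed_vector \<Rightarrow>\<^sub>L 'a" and G
  assumes green: "green A G"
begin

text \<open>Off the diagonal a column solves the homogeneous equation. At \<open>Suc m = n\<close>
  the term \<open>A m o\<^sub>L G m n\<close> is minus the complementary projection while
  \<open>G n n\<close> is the projection itself, so the gap is the identity.\<close>

lemma green_left: "G (Suc m) n = (A m o\<^sub>L G m n) + (if Suc m = n then id_blinfun else 0)"
  using green unfolding green_def by blast

lemma green_right: "G m n = (G m (Suc n) o\<^sub>L A n) + (if m = n then id_blinfun else 0)"
  using green unfolding green_def by blast

lemma green_compose_diag: "G m n o\<^sub>L G n n = (if n \<le> m then G m n else 0)"
  using green unfolding green_def by blast

lemma green_eq_evol_diag: "n \<le> m \<Longrightarrow> G m n = evol A m n o\<^sub>L G n n"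
proof (induction m)
  case (Suc m)
  then show ?case
    by (cases "n = Suc m") (auto simp: blinfun_compose_assoc green_left)
qed simp

lemma green_eq_diag_evol: "n \<le> m \<Longrightarrow> G m n = G m m o\<^sub>L evol A m n"
proof (induction rule: inc_induct)
  case (step n)
  then show ?case
    using green_right[of m n] by (simp add: evol_step_right blinfun_compose_assoc)
qed simp

text \<open>Running forward from an entry above the diagonal meets the jump only in the last step.
  Hence \<open>- G n m\<close> inverts the evolution from the right, up to the projection
  \<open>G m m\<close>.\<close>

lemma evol_compose_green: "n < m \<Longrightarrow> evol A m n o\<^sub>L G n m = G m m - id_blinfun"
proof -
  have "n \<le> k \<Longrightarrow> k < m \<Longrightarrow> evol A k n o\<^sub>L G n m = G k m" for k
    by (induction k) (auto simp: le_Suc_eq blinfun_compose_assoc green_left)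
  moreover assume "n < m"
  moreover then obtain k where "m = Suc k" "n \<le> k" by (cases m) auto
  ultimately show ?thesis
    using green_left[of k m] by (simp add: blinfun_compose_assoc)
qed

lemma green_compose_evol: "n < m \<Longrightarrow> G n m o\<^sub>L evol A m n = G n n - id_blinfun"
proof -
  have "n < k \<Longrightarrow> G n k o\<^sub>L evol A k n = G n n - id_blinfun" for k
  proof (induction k)
    case (Suc k)
    then show ?case
      using green_right[of n k]
      by (cases "n = k") (auto simp: blinfun_compose_assoc[symmetric])
  qed simp
  then show "n < m \<Longrightarrow> ?thesis" .
qed

text \<open>Bracketing the product of \<open>G n m\<close>, \<open>evol A m n\<close> and
  \<open>G n m\<close> in two ways, with \<open>G n m o\<^sub>L G m m = 0\<close> on one side, shows
  that backward evolution lands in the kernel of \<open>G n n\<close>.\<close>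

lemma diag_compose_green:
  assumes "n < m"
  shows "G n n o\<^sub>L G n m = 0"
proof -
  have "(G n m o\<^sub>L evol A m n) o\<^sub>L G n m = G n m o\<^sub>L (G m m - id_blinfun)"
    using evol_compose_green[OF assms] by (simp add: blinfun_compose_assoc)
  then show ?thesis
    using assms green_compose_diag[of n m] by (simp add: green_compose_evol blinfun_compose_simps)
qed

text \<open>Forward entries factor through the projection at \<open>n\<close>, backward ones through
  its complement, so mixed products vanish. Two backward factors carry two minus signs, whence
  \<open>- G m j\<close>.\<close>

lemma green_compose:
  "G m n o\<^sub>L G n j =
     (if n \<le> m then if j \<le> n then G m j else 0 else if j \<le> n then 0 else - G m j)"
proof (cases "n \<le> m")
  case True
  have "G m n o\<^sub>L G n j = evol A m n o\<^sub>L (G n n o\<^sub>L G n j)"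
    by (simp add: green_eq_evol_diag[OF True] blinfun_compose_assoc)
  moreover have "G n n o\<^sub>L G n j = G n j" if "j \<le> n"
    using green_eq_diag_evol[OF that] green_compose_diag[of n n]
    by (simp add: blinfun_compose_assoc[symmetric])
  moreover have "evol A m n o\<^sub>L G n j = G m j" if "j \<le> n"
    using True that green_eq_evol_diag[of j n] green_eq_evol_diag[of j m] evol_trans[of j n m A]
    by (simp add: blinfun_compose_assoc)
  ultimately show ?thesis using True diag_compose_green[of n j] by auto
next
  case False
  have "G m n o\<^sub>L G n j = - G m j" if "n < j"
  proof -
    have "evol A n m o\<^sub>L G m j = G n j"
    proof -
      have "k < j \<Longrightarrow> m \<le> k \<Longrightarrow> evol A k m o\<^sub>L G m j = G k j" for k
        by (induction k) (auto simp: le_Suc_eq blinfun_compose_assoc green_left)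
      then show ?thesis using False that by simp
    qed
    then have "G m n o\<^sub>L G n j = (G m n o\<^sub>L evol A n m) o\<^sub>L G m j"
      by (simp add: blinfun_compose_assoc)
    also have "\<dots> = - G m j"
      using False that diag_compose_green[of m j] by (simp add: green_compose_evol blinfun_compose_simps)
    finally show ?thesis .
  qed
  moreover have "G m n o\<^sub>L G n j = 0" if "j \<le> n"
    using False green_compose_diag[of m n]
    by (simp add: green_eq_diag_evol[OF that] blinfun_compose_assoc[symmetric])
  ultimately show ?thesis using False by auto
qed

end

section \<open>Perturbation of Green kernels\<close>

text \<open>The weights \<open>w n\<close> depend on the column and give the sharp bounds, whereas
  comparing columns \<open>n\<close> and \<open>Suc n\<close> needs uniqueness in one space;
  \<open>v\<close> provides it, since \<open>w n\<close> is at most \<open>L n * v\<close>.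
  \<open>Q_le\<close> is separate because a bound on \<open>G n n\<close> controls only the forward
  projection.\<close>

theorem green_perturbation:
  fixes A B :: "nat \<Rightarrow> 'a::banach \<Rightarrow>\<^sub>L 'a" and C L :: "nat \<Rightarrow> real"
  assumes green: "green A G"
    and weight: "\<And>n. weighted_kernel (\<lambda>m k. G m (Suc k) o\<^sub>L B k) (w n) c \<theta>"
    and common: "weighted_kernel (\<lambda>m k. G m (Suc k) o\<^sub>L B k) v c \<theta>"
    and w_le: "\<And>m n. w n m \<le> L n * v m"
    and G_le: "\<And>m n. norm (G m n) \<le> C n * w n m"
    and Q_le: "\<And>n. norm (id_blinfun - G n n) \<le> C n * w n n"
  obtains H where "green (\<lambda>n. A n + B n) H"
    and "\<And>m n. norm (H m n) \<le> C n / (1 - \<theta>) * w n m"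
    and "\<And>n. norm (id_blinfun - H n n) \<le> C n / (1 - \<theta>) * w n n"
proof -
  define K where "K m k = G m (Suc k) o\<^sub>L B k" for m k
  \<comment> \<open>The series defining \<open>kernel_op\<close> contains no weight, so the same
    \<open>T\<close> belongs to all interpretations below.\<close>
  define T where "T = weighted_kernel.kernel_op K"
  have K: "K = (\<lambda>m k. G m (Suc k) o\<^sub>L B k)"
    by (simp add: K_def fun_eq_iff)
  have wk: "weighted_kernel K (w n) c \<theta>" for n
    unfolding K by (rule weight)
  have vk: "weighted_kernel K v c \<theta>"
    unfolding K by (rule common)
  interpret V: weighted_kernel K v c \<theta>
    rewrites "weighted_kernel.kernel_op K \<equiv> T"
    by (rule vk) (simp only: T_def)
  have "\<exists>x. (\<forall>m. norm (x m) \<le> C n / (1 - \<theta>) * w n m) \<and> (\<forall>m. x m = G m n + T x m)" for n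
  proof -
    interpret W: weighted_kernel K "w n" c \<theta>
      rewrites "weighted_kernel.kernel_op K \<equiv> T"
      by (rule wk) (simp only: T_def)
    have "W.bounded_by (C n) (\<lambda>m. G m n)"
      using G_le by (simp add: W.bounded_by_def)
    then obtain x where "W.bounded_by (C n / (1 - \<theta>)) x" "\<And>m. x m = G m n + T x m"
      by (rule W.kernel_op_fixpoint) (rule that)
    then show ?thesis
      unfolding W.bounded_by_def by blast
  qed
  then obtain h where "\<forall>n. (\<forall>m. norm (h n m) \<le> C n / (1 - \<theta>) * w n m) \<and>
      (\<forall>m. h n m = G m n + T (h n) m)"
    using choice[where Q = "\<lambda>n x. (\<forall>m. norm (x m) \<le> C n / (1 - \<theta>) * w n m) \<and>
      (\<forall>m. x m = G m n + T x m)"] by blast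
  then have h: "norm (h n m) \<le> C n / (1 - \<theta>) * w n m" "h n m = G m n + T (h n) m" for m n
    by blast+
  have bounded: "V.bounded_by (C n / (1 - \<theta>) * L n) (h n)" for n
    unfolding V.bounded_by_def
  proof
    fix m
    have "0 \<le> C n * w n n"
      using G_le[of n n] norm_ge_zero order_trans by blast
    then have "0 \<le> C n / (1 - \<theta>)"
      using weighted_kernel.w_pos[OF wk, of n n] V.\<theta>_less by (simp add: zero_le_mult_iff)
    then show "norm (h n m) \<le> C n / (1 - \<theta>) * L n * v m"
      using order_trans[OF h(1) mult_left_mono[OF w_le]] by (simp add: mult.assoc)
  qed
  \<comment> \<open>The jump of \<open>G\<close> at \<open>Suc m = Suc k\<close> contributes
    \<open>B m o\<^sub>L x m\<close>, which turns \<open>A m\<close> into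
    \<open>A m + B m\<close>.\<close>
  have left: "T x (Suc m) = (A m o\<^sub>L T x m) + (B m o\<^sub>L x m)" if x: "V.bounded_by M x" for x m M
  proof -
    have "(\<lambda>k. (A m o\<^sub>L (K m k o\<^sub>L x k)) + (if k = m then B k o\<^sub>L x k else 0))
        sums ((A m o\<^sub>L T x m) + (B m o\<^sub>L x m))"
      by (intro sums_add sums_single bounded_linear.sums[OF bounded_bilinear.bounded_linear_right[OF
          bounded_bilinear_blinfun_compose] V.kernel_op_sums[OF x]])
    moreover have "(A m o\<^sub>L (K m k o\<^sub>L x k)) + (if k = m then B k o\<^sub>L x k else 0)
        = K (Suc m) k o\<^sub>L x k" for k
      using green_left[OF green, of m "Suc k"] by (auto simp: K_def blinfun_compose_assoc blinfun_compose_simps)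
    ultimately show ?thesis
      using V.kernel_op_sums[OF x, of "Suc m"] by (simp add: sums_iff)
  qed
  have H_left: "h n (Suc m) = ((A m + B m) o\<^sub>L h n m) + (if Suc m = n then id_blinfun else 0)" for m n
  proof -
    have "h n (Suc m) = G (Suc m) n + T (h n) (Suc m)"
      by (rule h(2))
    also have "\<dots> = (A m o\<^sub>L (G m n + T (h n) m)) + (B m o\<^sub>L h n m)
        + (if Suc m = n then id_blinfun else 0)"
      unfolding left[OF bounded] green_left[OF green, of m n] by (simp add: blinfun_compose_simps)
    finally show ?thesis
      by (simp add: blinfun_compose_simps h(2)[symmetric])
  qed
  have H_right: "h n m = (h (Suc n) m o\<^sub>L (A n + B n)) + (if m = n then id_blinfun else 0)" for m n
  proof -
    let ?S = "A n + B n" and ?\<delta> = "\<lambda>m. if m = n then id_blinfun :: 'a \<Rightarrow>\<^sub>L 'a else 0"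
    let ?f = "\<lambda>m. G m (Suc n) o\<^sub>L ?S"
    \<comment> \<open>Both sides solve the fixed point equation with inhomogeneity
      \<open>?f\<close>. On the left, \<open>T\<close> maps the spike to \<open>K m n\<close>, which
      cancels the \<open>B n\<close> part of \<open>?f\<close>.\<close>
    have "h n m - ?\<delta> m = h (Suc n) m o\<^sub>L ?S"
    proof (rule V.kernel_op_unique[where f = ?f and x = "\<lambda>m. h n m - ?\<delta> m"
          and y = "\<lambda>m. h (Suc n) m o\<^sub>L ?S"])
      show "V.bounded_by (C n / (1 - \<theta>) * L n + norm (id_blinfun :: 'a \<Rightarrow>\<^sub>L 'a) / v n)
          (\<lambda>m. h n m - ?\<delta> m)"
        by (rule V.bounded_by_diff[OF bounded V.bounded_by_single])
      show "V.bounded_by (C (Suc n) / (1 - \<theta>) * L (Suc n) * norm ?S) (\<lambda>m. h (Suc n) m o\<^sub>L ?S)"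
        by (rule V.bounded_by_compose[OF bounded])
      fix m
      show "h n m - ?\<delta> m = ?f m + T (\<lambda>m. h n m - ?\<delta> m) m"
        unfolding V.kernel_op_diff[OF bounded V.bounded_by_single] V.kernel_op_single
        using h(2)[of n m] green_right[OF green, of m n] by (simp add: K_def blinfun_compose_simps)
      show "h (Suc n) m o\<^sub>L ?S = ?f m + T (\<lambda>m. h (Suc n) m o\<^sub>L ?S) m"
        unfolding V.kernel_op_compose[OF bounded]
        by (subst h(2)) (simp add: blinfun_compose_simps)
    qed
    then show ?thesis
      by (simp only: diff_eq_eq)
  qed
  have H_idem: "h n m o\<^sub>L h n n = (if n \<le> m then h n m else 0)" for m n
  proof -
    let ?y = "\<lambda>m. if n \<le> m then h n m else 0" and ?f = "\<lambda>m. G m n o\<^sub>L h n n"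
    \<comment> \<open>The product and the cut-off column solve the same equation, with inhomogeneity
      \<open>?f\<close>.\<close>
    show ?thesis
    proof (rule V.kernel_op_unique[where f = ?f and x = "\<lambda>m. h n m o\<^sub>L h n n" and y = ?y])
      show "V.bounded_by (C n / (1 - \<theta>) * L n * norm (h n n)) (\<lambda>m. h n m o\<^sub>L h n n)"
        by (rule V.bounded_by_compose[OF bounded])
      show y: "V.bounded_by (C n / (1 - \<theta>) * L n) ?y"
        by (rule V.bounded_by_truncate[OF bounded])
      fix m
      show "h n m o\<^sub>L h n n = ?f m + T (\<lambda>m. h n m o\<^sub>L h n n) m"
        unfolding V.kernel_op_compose[OF bounded]
        by (subst h(2)) (simp add: blinfun_compose_simps)
      \<comment> \<open>With \<open>h n n\<close> expanded inside \<open>?f\<close>, the composition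
        law acts termwise. For \<open>n \<le> m\<close> the first summand supplies exactly the terms
        \<open>k < n\<close> missing from \<open>T ?y\<close>; for \<open>m < n\<close> the two
        summands cancel or both vanish.\<close>
      have "(\<lambda>k. (G m n o\<^sub>L (K n k o\<^sub>L h n k)) + (K m k o\<^sub>L ?y k)) sums
          ((G m n o\<^sub>L T (h n) n) + T ?y m)"
        by (intro sums_add V.kernel_op_sums[OF y]
            bounded_linear.sums[OF bounded_bilinear.bounded_linear_right[OF
            bounded_bilinear_blinfun_compose] V.kernel_op_sums[OF bounded]])
      moreover have "(G m n o\<^sub>L (K n k o\<^sub>L h n k)) + (K m k o\<^sub>L ?y k)
          = (if n \<le> m then K m k o\<^sub>L h n k else 0)" for k
        using green_compose[OF green, of m n "Suc k"]
        by (auto simp: K_def blinfun_compose_assoc[symmetric] blinfun_compose_simps)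
      ultimately have "(G m n o\<^sub>L T (h n) n) + T ?y m = (if n \<le> m then T (h n) m else 0)"
        using V.kernel_op_sums[OF bounded, of m n] by (auto simp: sums_iff)
      then show "?y m = ?f m + T ?y m"
        using h(2)[of n n] h(2)[of n m] green_compose_diag[OF green, of m n]
        by (simp add: blinfun_compose_simps add.assoc)
    qed
  qed
  \<comment> \<open>The correction \<open>T (h n) n\<close> adds \<theta> times
    \<open>C n / (1 - \<theta>)\<close> to \<open>C n\<close>, which is
    \<open>C n / (1 - \<theta>)\<close> again.\<close>
  have H_diag: "norm (id_blinfun - h n n) \<le> C n / (1 - \<theta>) * w n n" for n
  proof -
    interpret W: weighted_kernel K "w n" c \<theta>
      rewrites "weighted_kernel.kernel_op K \<equiv> T"
      by (rule wk) (simp only: T_def)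
    have "W.bounded_by (C n / (1 - \<theta>)) (h n)"
      using h(1) by (simp add: W.bounded_by_def)
    then have "norm (T (h n) n) \<le> \<theta> * (C n / (1 - \<theta>)) * w n n"
      using W.bounded_by_kernel_op W.bounded_by_def by blast
    then have "norm ((id_blinfun - G n n) - T (h n) n) \<le> C n * w n n + \<theta> * (C n / (1 - \<theta>)) * w n n"
      using norm_triangle_ineq4 add_mono[OF Q_le] order_trans by blast
    moreover have "id_blinfun - h n n = (id_blinfun - G n n) - T (h n) n"
      using h(2)[of n n] by (simp add: algebra_simps)
    moreover have "C n * w n n + \<theta> * (C n / (1 - \<theta>)) * w n n = C n / (1 - \<theta>) * w n n"
      using W.\<theta>_less by (simp add: field_simps)
    ultimately show ?thesis by (simp only:)
  qed
  show thesis
  proof (rule that[of "\<lambda>m n. h n m"])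
    show "green (\<lambda>n. A n + B n) (\<lambda>m n. h n m)"
      unfolding green_def using H_left H_right H_idem by blast
  qed (rule h(1) H_diag)+
qed

section \<open>From Green kernels to dichotomies\<close>

lemma idx_ge_iff: "(m, n) \<in> idx_ge \<longleftrightarrow> (\<exists>m' n'. m = Suc m' \<and> n = Suc n' \<and> n' \<le> m')"
  by (cases m; cases n) (auto simp: idx_ge_def)

lemma idx_le_iff: "(m, n) \<in> idx_le \<longleftrightarrow> (\<exists>m' n'. m = Suc m' \<and> n = Suc n' \<and> m' \<le> n')"
  by (cases m; cases n) (auto simp: idx_le_def)

lemma mem_blinfun_ker: "x \<in> blinfun_ker T \<longleftrightarrow> T x = 0"
  by (simp add: blinfun_ker_def)

text \<open>\<open>W\<close> extends the inverse between the kernels by zero along the range of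
  \<open>G m m\<close>. On the diagonal \<open>- G n n\<close> would be minus the forward
  projection, so the complement takes its place.\<close>

lemma green_kernel_inverse:
  assumes "green A G" "n \<le> m"
  defines "W \<equiv> (if n < m then - G n m else id_blinfun - G n n)"
  shows "evol A m n o\<^sub>L W = id_blinfun - G m m"
    and "W o\<^sub>L evol A m n = id_blinfun - G n n"
    and "G n n o\<^sub>L W = 0"
    and "W o\<^sub>L (id_blinfun - G m m) = W"
  using assms(2) evol_compose_green[OF assms(1), of n m] green_compose_evol[OF assms(1), of n m]
    diag_compose_green[OF assms(1), of n m] green_compose_diag[OF assms(1), of n m]
    green_compose_diag[OF assms(1), of n n]
  by (auto simp: W_def blinfun_compose_simps)

lemma general_dichotomy_if_green:
  fixes A :: "nat \<Rightarrow> 'a::real_normed_vector \<Rightarrow>\<^sub>L 'a"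
  assumes green: "green (\<lambda>n. A (Suc n)) G"
    and le_a: "\<And>m n. n \<le> m \<Longrightarrow> norm (G m n) \<le> a (Suc m) (Suc n)"
    and le_b: "\<And>m n. m < n \<Longrightarrow> norm (G m n) \<le> b (Suc m) (Suc n)"
    and le_diag: "\<And>n. norm (id_blinfun - G n n) \<le> b (Suc n) (Suc n)"
  shows "general_dichotomy A a b"
proof -
  define E where "E m n = evol A (Suc m) (Suc n)" for m n
  have E: "E = evol (\<lambda>n. A (Suc n))"
    by (intro ext) (simp only: E_def evol_shift)
  \<comment> \<open>The projections are the diagonal of the kernel; \<open>n - 1\<close> undoes the
    index shift, as splittings start at index 1.\<close>
  define P where "P n = G (n - 1) (n - 1)" for n
  have P_Suc [simp]: "P (Suc n) = G n n" for n
    by (simp add: P_def)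
  define W where "W n m = (if n < m then - G n m else id_blinfun - G n n)" for n m
  note W = green_kernel_inverse[OF green, folded W_def E]
  have idem: "G n n o\<^sub>L G n n = G n n" for n
    using green_compose_diag[OF green, of n n] by simp
  have inv: "G m m o\<^sub>L E m n = E m n o\<^sub>L G n n" if "n \<le> m" for m n
    using that green_eq_evol_diag[OF green that] green_eq_diag_evol[OF green that] by (simp add: E)
  have W_apply: "E m n (W n m y) = y - G m m y" "W n m (E m n x) = x - G n n x"
    "G n n (W n m y) = 0" "W n m (y - G m m y) = W n m y" if "n \<le> m" for m n x y
    using W[OF that, THEN arg_cong[where f = "\<lambda>T. blinfun_apply T x"]]
      W[OF that, THEN arg_cong[where f = "\<lambda>T. blinfun_apply T y"]]
    by (simp_all add: blinfun.bilinear_simps)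
  have inv_apply: "G m m (E m n x) = E m n (G n n x)" if "n \<le> m" for m n x
    using inv[OF that, THEN arg_cong[where f = "\<lambda>T. blinfun_apply T x"]] by simp
  have bij: "bij_betw (E m n) (blinfun_ker (G n n)) (blinfun_ker (G m m))" if "n \<le> m" for m n
    by (rule bij_betw_byWitness[where f' = "W n m"])
       (auto simp: mem_blinfun_ker W_apply[OF that] inv_apply[OF that])
  have bwd: "evol_back A P (Suc n) (Suc m) y = W n m y"
    if "n \<le> m" "y \<in> blinfun_ker (G m m)" for m n y
    unfolding evol_back_def P_Suc E_def[symmetric]
    using bij[OF that(1)] that W_apply[OF that(1)]
    by (intro inv_into_f_eq) (auto simp: bij_betw_def mem_blinfun_ker)
  have splitting: "invariant_splitting A P"
    unfolding invariant_splitting_def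
  proof (intro conjI allI ballI impI)
    fix n :: nat
    assume "1 \<le> n"
    then show "P n o\<^sub>L P n = P n"
      by (simp add: P_def idem)
  next
    fix p assume "p \<in> idx_ge"
    then obtain m n where p: "p = (Suc m, Suc n)" and mn: "n \<le> m"
      by (cases p) (auto simp: idx_ge_iff)
    have "\<exists>K. \<forall>y\<in>blinfun_ker (G m m). norm (evol_back A P (Suc n) (Suc m) y) \<le> K * norm y"
      by (rule exI[of _ "norm (W n m)"]) (simp add: bwd[OF mn] norm_blinfun)
    then show "case p of (m, n) \<Rightarrow>
        P m o\<^sub>L evol A m n = evol A m n o\<^sub>L P n \<and>
        evol A m n ` blinfun_ker (P n) = blinfun_ker (P m) \<and>
        bij_betw (evol A m n) (blinfun_ker (P n)) (blinfun_ker (P m)) \<and>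
        (\<exists>K. \<forall>y\<in>blinfun_ker (P m). norm (evol_back A P n m y) \<le> K * norm y)"
      using bij[OF mn] inv[OF mn]
      unfolding p prod.case P_Suc E_def[symmetric] bij_betw_def by blast
  qed
  have bound_a: "norm (evol A m n o\<^sub>L P n) \<le> a m n" if idx: "(m, n) \<in> idx_ge" for m n
  proof -
    from idx obtain m' n' where mn: "m = Suc m'" "n = Suc n'" "n' \<le> m'"
      unfolding idx_ge_iff by blast
    then show ?thesis
      using le_a[of n' m'] green_eq_evol_diag[OF green, of n' m', folded E]
      unfolding mn P_Suc E_def[symmetric] by simp
  qed
  have bound_b: "onorm (evol_back A P m n \<circ> (id_blinfun - P n)) \<le> b m n"
    if idx: "(m, n) \<in> idx_le" for m n
  proof -
    from idx obtain m' n' where mn: "m = Suc m'" "n = Suc n'" "m' \<le> n'"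
      unfolding idx_le_iff by blast
    \<comment> \<open>Agreement with the bounded operator \<open>W m' n'\<close> on the whole space
      turns \<open>onorm\<close> into its norm.\<close>
    have "evol_back A P m n \<circ> (id_blinfun - P n) = W m' n'"
    proof
      fix x
      have "G n' n' (x - G n' n' x) = 0"
        using idem[of n', THEN arg_cong[where f = "\<lambda>T. blinfun_apply T x"]]
        by (simp add: blinfun.bilinear_simps)
      then show "(evol_back A P m n \<circ> (id_blinfun - P n)) x = W m' n' x"
        using bwd[OF mn(3), of "x - G n' n' x"] W_apply(4)[OF mn(3), of x]
        by (simp add: mn mem_blinfun_ker blinfun.diff_left)
    qed
    then show ?thesis
      using le_b[of m' n'] le_diag[of m'] mn
      by (auto simp: norm_blinfun.rep_eq[symmetric] W_def)
  qed
  show ?thesis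
    unfolding general_dichotomy_def using splitting bound_a bound_b by blast
qed

section \<open>From dichotomies to Green kernels\<close>

text \<open>The backward evolution is only an \<open>inv_into\<close> of a restriction. Precomposed
  with the complementary projection it becomes a bounded operator \<open>R\<close>, whose identities
  are checked after applying the forward evolution, which is injective on the kernels.\<close>

lemma green_if_general_dichotomy:
  fixes A :: "nat \<Rightarrow> 'a::real_normed_vector \<Rightarrow>\<^sub>L 'a"
  assumes "general_dichotomy A a b"
  obtains G where "green (\<lambda>n. A (Suc n)) G"
    and "\<And>m n. n \<le> m \<Longrightarrow> norm (G m n) \<le> a (Suc m) (Suc n)"
    and "\<And>m n. m < n \<Longrightarrow> norm (G m n) \<le> b (Suc m) (Suc n)"
    and "\<And>n. norm (id_blinfun - G n n) \<le> b (Suc n) (Suc n)"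
proof -
  obtain P' where splitting: "invariant_splitting A P'"
    and bound_a: "\<And>m n. (m, n) \<in> idx_ge \<Longrightarrow> norm (evol A m n o\<^sub>L P' n) \<le> a m n"
    and bound_b: "\<And>m n. (m, n) \<in> idx_le \<Longrightarrow>
          onorm (evol_back A P' m n \<circ> (id_blinfun - P' n)) \<le> b m n"
    using assms unfolding general_dichotomy_def by blast
  define P where "P n = P' (Suc n)" for n
  define E where "E m n = evol A (Suc m) (Suc n)" for m n
  have E: "E = evol (\<lambda>n. A (Suc n))"
    by (intro ext) (simp only: E_def evol_shift)
  define bwd where "bwd n m = evol_back A P' (Suc n) (Suc m)" for n m
  have idem: "P n o\<^sub>L P n = P n" for n
    using splitting unfolding invariant_splitting_def P_def by auto
  have split: "P m o\<^sub>L E m n = E m n o\<^sub>L P n"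
      "bij_betw (E m n) (blinfun_ker (P n)) (blinfun_ker (P m))"
      "\<exists>K. \<forall>y\<in>blinfun_ker (P m). norm (bwd n m y) \<le> K * norm y" if "n \<le> m" for m n
  proof -
    have "(Suc m, Suc n) \<in> idx_ge"
      using that by (simp add: idx_ge_def)
    with splitting have "P m o\<^sub>L E m n = E m n o\<^sub>L P n \<and>
      bij_betw (E m n) (blinfun_ker (P n)) (blinfun_ker (P m)) \<and>
      (\<exists>K. \<forall>y\<in>blinfun_ker (P m). norm (bwd n m y) \<le> K * norm y)"
      unfolding invariant_splitting_def P_def E_def bwd_def by blast
    then show "P m o\<^sub>L E m n = E m n o\<^sub>L P n"
      "bij_betw (E m n) (blinfun_ker (P n)) (blinfun_ker (P m))"
      "\<exists>K. \<forall>y\<in>blinfun_ker (P m). norm (bwd n m y) \<le> K * norm y"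
      by blast+
  qed
  have bwd_def': "bwd n m = inv_into (blinfun_ker (P n)) (E m n)" for m n
    by (simp only: bwd_def evol_back_def E_def P_def)
  have inj: "x = y" if "n \<le> m" "P n x = 0" "P n y = 0" "E m n x = E m n y" for m n x y
  proof -
    have "inj_on (E m n) (blinfun_ker (P n))"
      by (rule bij_betw_imp_inj_on) (rule split(2)[OF that(1)])
    then show ?thesis
      by (rule inj_onD) (simp_all only: mem_blinfun_ker that)
  qed
  have cancel: "S = T" if "n \<le> m" "P n o\<^sub>L S = 0" "P n o\<^sub>L T = 0" "E m n o\<^sub>L S = E m n o\<^sub>L T"
    for m n and S T :: "'a \<Rightarrow>\<^sub>L 'a"
  proof (rule blinfun_eqI)
    fix x
    show "S x = T x"
      using that(2-)[THEN arg_cong[where f = "\<lambda>T. blinfun_apply T x"]]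
      by - (rule inj[OF that(1)], simp_all)
  qed
  have bwd: "P n (bwd n m y) = 0" "E m n (bwd n m y) = y" if "n \<le> m" "P m y = 0" for m n y
  proof -
    have y: "y \<in> E m n ` blinfun_ker (P n)"
      using split(2)[OF that(1)] that(2) by (simp add: bij_betw_def mem_blinfun_ker)
    show "P n (bwd n m y) = 0"
      using inv_into_into[OF y] by (simp add: bwd_def' mem_blinfun_ker)
    show "E m n (bwd n m y) = y"
      using f_inv_into_f[OF y] by (simp add: bwd_def')
  qed
  have PQ: "P n (x - P n x) = 0" for n x
    using idem[of n, THEN arg_cong[where f = "\<lambda>T. blinfun_apply T x"]]
    by (simp add: blinfun.bilinear_simps)
  have bounded_linear_bwd: "bounded_linear (bwd n m \<circ> (id_blinfun - P m))" if nm: "n \<le> m" for m n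
  proof -
    obtain K where K: "norm (bwd n m y) \<le> K * norm y" if "P m y = 0" for y
      using split(3)[OF nm] unfolding blinfun_ker_def by blast
    let ?Q = "id_blinfun - P m"
    have Q: "P m (?Q x) = 0" for x
      using PQ by (simp add: blinfun.bilinear_simps)
    show ?thesis
    proof (rule bounded_linear_intro)
      show "(bwd n m \<circ> ?Q) (x + y) = (bwd n m \<circ> ?Q) x + (bwd n m \<circ> ?Q) y" for x y
        unfolding o_def by (rule inj[OF nm]) (simp_all add: bwd[OF nm] Q blinfun.add_right)
      show "(bwd n m \<circ> ?Q) (r *\<^sub>R x) = r *\<^sub>R (bwd n m \<circ> ?Q) x" for r x
        unfolding o_def by (rule inj[OF nm]) (simp_all add: bwd[OF nm] Q blinfun.scaleR_right)
      \<comment> \<open>The constant \<open>K\<close> of the splitting may be negative when the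
        kernel is trivial, hence the absolute value.\<close>
      show "norm ((bwd n m \<circ> ?Q) x) \<le> norm x * (\<bar>K\<bar> * norm ?Q)" for x
      proof -
        have "norm (bwd n m (?Q x)) \<le> \<bar>K\<bar> * norm (?Q x)"
          by (rule order_trans[OF K[OF Q]]) (intro mult_right_mono, auto)
        also have "\<dots> \<le> \<bar>K\<bar> * (norm ?Q * norm x)"
          by (intro mult_left_mono norm_blinfun) auto
        finally show ?thesis by (simp add: mult_ac)
      qed
    qed
  qed
  define R where "R n m = Blinfun (bwd n m \<circ> (id_blinfun - P m))" for n m
  have R_apply: "blinfun_apply (R n m) = bwd n m \<circ> (id_blinfun - P m)" if "n \<le> m" for m n
    unfolding R_def by (rule bounded_linear_Blinfun_apply[OF bounded_linear_bwd[OF that]])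
  have R: "P n o\<^sub>L R n m = 0" "E m n o\<^sub>L R n m = id_blinfun - P m" if "n \<le> m" for m n
    by (rule blinfun_eqI, simp add: R_apply[OF that] bwd[OF that] PQ blinfun.diff_left)+
  have norm_R: "norm (R m n) \<le> b (Suc m) (Suc n)" if "m \<le> n" for m n
    using bound_b[of "Suc m" "Suc n"] that
    by (simp add: norm_blinfun.rep_eq R_apply bwd_def P_def idx_le_def)
  have E_self: "E n n = id_blinfun" for n
    by (simp add: E_def)
  have E_step: "E (Suc m) n = A (Suc m) o\<^sub>L E m n" if "n \<le> m" for m n
    using that by (simp add: E)
  have E_step_right: "E m n = E m (Suc n) o\<^sub>L A (Suc n)" if "n < m" for m n
    using evol_step_right[OF that, of "\<lambda>n. A (Suc n)"] by (simp add: E)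
  have inv: "P (Suc n) o\<^sub>L A (Suc n) = A (Suc n) o\<^sub>L P n" for n
    using split(1)[of n "Suc n"] by (simp add: E_step E_self)
  have PQ': "P n o\<^sub>L (id_blinfun - P n) = 0" for n
    by (simp add: blinfun_compose_simps idem)
  have R_self: "R n n = id_blinfun - P n" for n
    using R(2)[of n n] by (simp add: E_self)
  have R_left: "A (Suc m) o\<^sub>L R m n = R (Suc m) n" if "m < n" for m n
  proof (rule cancel[of "Suc m" n])
    show "P (Suc m) o\<^sub>L (A (Suc m) o\<^sub>L R m n) = 0"
      using R(1)[of m n] that by (simp add: blinfun_compose_assoc[symmetric] inv)
        (simp add: blinfun_compose_assoc)
    show "E n (Suc m) o\<^sub>L (A (Suc m) o\<^sub>L R m n) = E n (Suc m) o\<^sub>L R (Suc m) n"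
      using R(2)[of m n] R(2)[of "Suc m" n] that
      by (simp add: blinfun_compose_assoc[symmetric] E_step_right[symmetric])
  qed (use that R(1) in auto)
  have R_right: "R m (Suc n) o\<^sub>L A (Suc n) = R m n" if "m \<le> n" for m n
  proof (rule cancel[of m "Suc n"])
    show "P m o\<^sub>L (R m (Suc n) o\<^sub>L A (Suc n)) = 0"
      using R(1)[of m "Suc n"] that by (simp add: blinfun_compose_assoc[symmetric])
    show "E (Suc n) m o\<^sub>L (R m (Suc n) o\<^sub>L A (Suc n)) = E (Suc n) m o\<^sub>L R m n"
      using R(2)[of m n] R(2)[of m "Suc n"] that E_step[OF that]
      by (simp add: blinfun_compose_assoc[symmetric] blinfun_compose_simps inv)
        (simp add: blinfun_compose_assoc blinfun_compose_simps)
  qed (use that R(1) in auto)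
  \<comment> \<open>The minus sign produces the jump: \<open>P n\<close> and \<open>- R n n\<close>
    differ by the identity.\<close>
  define G where "G m n = (if n \<le> m then E m n o\<^sub>L P n else - R m n)" for m n
  have "green (\<lambda>n. A (Suc n)) G"
    unfolding green_def
  proof (intro conjI allI)
    fix m n
    show "G (Suc m) n = (A (Suc m) o\<^sub>L G m n) + (if Suc m = n then id_blinfun else 0)"
    proof (cases n "Suc m" rule: linorder_cases)
      case less
      then show ?thesis by (simp add: G_def E_step blinfun_compose_assoc)
    next
      case equal
      then show ?thesis using R_left[of m n] by (simp add: G_def E_self R_self blinfun_compose_simps)
    next
      case greater
      then show ?thesis using R_left[of m n] by (simp add: G_def blinfun_compose_simps)
    qed
    show "G m n = (G m (Suc n) o\<^sub>L A (Suc n)) + (if m = n then id_blinfun else 0)"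
    proof (cases m n rule: linorder_cases)
      case greater
      then show ?thesis
        using E_step_right[OF greater] by (simp add: G_def blinfun_compose_assoc inv)
    next
      case equal
      then show ?thesis using R_right[of m n] by (simp add: G_def E_self R_self blinfun_compose_simps)
    next
      case less
      then show ?thesis using R_right[of m n] by (simp add: G_def blinfun_compose_simps)
    qed
    have "R m n o\<^sub>L P n = 0" if "m < n"
    proof (rule cancel[of m n])
      show "P m o\<^sub>L (R m n o\<^sub>L P n) = 0"
        using R(1)[of m n] that by (simp add: blinfun_compose_assoc[symmetric])
      show "E n m o\<^sub>L (R m n o\<^sub>L P n) = E n m o\<^sub>L 0"
        using R(2)[of m n] that by (simp add: blinfun_compose_assoc[symmetric] blinfun_compose_simps idem)
    qed (use that in auto)
    then show "G m n o\<^sub>L G n n = (if n \<le> m then G m n else 0)"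
      by (auto simp: G_def E_self blinfun_compose_assoc idem blinfun_compose_simps)
  qed
  moreover have "norm (G m n) \<le> a (Suc m) (Suc n)" if "n \<le> m" for m n
    using bound_a[of "Suc m" "Suc n"] that
    unfolding E_def[symmetric] P_def[symmetric] by (simp add: G_def idx_ge_def)
  moreover have "norm (G m n) \<le> b (Suc m) (Suc n)" if "m < n" for m n
    using norm_R[of m n] that by (simp add: G_def)
  moreover have "norm (id_blinfun - G n n) \<le> b (Suc n) (Suc n)" for n
    using norm_R[of n n] by (simp add: G_def E_self R_self)
  ultimately show thesis by (rule that)
qed

section \<open>Exponential bounds\<close>

theorem corollary8:
  fixes A B :: "nat \<Rightarrow> 'a::banach \<Rightarrow>\<^sub>L 'a"
    and D \<epsilon> a b \<delta> \<gamma> \<theta> :: real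
  assumes "D \<ge> 1" and "\<epsilon> \<ge> 0"
    and "general_dichotomy A
           (\<lambda>m n. D * exp (a * (real m - real n) + \<epsilon> * real n))
           (\<lambda>m n. D * exp (b * (real m - real n) + \<epsilon> * real n))"
    and "\<delta> > 0"
    and "\<And>n. n \<ge> 1 \<Longrightarrow> norm (B n) \<le> \<delta> * exp (- \<gamma> * (real n + 1))"
    and "a \<le> b"
    and "\<epsilon> - \<gamma> < 0"
    and "\<theta> = D * \<delta> * exp (2 * \<epsilon> - 2 * \<gamma> - a) * inverse (1 - exp (\<epsilon> - \<gamma>))"
    and "\<theta> < 1"
  shows "general_dichotomy (\<lambda>n. A n + B n)
           (\<lambda>m n. D / (1 - \<theta>) * exp (a * (real m - real n) + \<epsilon> * real n))
           (\<lambda>m n. D / (1 - \<theta>) * exp (b * (real m - real n) + \<epsilon> * real n))"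
proof -
  define r where "r t = min (a * t) (b * t)" for t :: real
  have r_nonneg: "r t = a * t" if "0 \<le> t" for t
    using mult_right_mono[OF \<open>a \<le> b\<close> that] by (simp add: r_def)
  have r_nonpos: "r t = b * t" if "t \<le> 0" for t
    using mult_right_mono_neg[OF \<open>a \<le> b\<close> that] by (simp add: r_def)
  have r_le: "r t \<le> a * t" for t
    by (simp add: r_def)
  \<comment> \<open>A minimum of linear functions is superadditive.\<close>
  have r_add: "r s + r t \<le> r (s + t)" for s t
    unfolding r_def min_add_distrib_left min_add_distrib_right by (simp add: distrib_left min_def)
  \<comment> \<open>Both slopes of \<open>r\<close>, \<open>b\<close> left of 0 and \<open>a\<close>
    right of it, are at least \<open>a\<close>.\<close>
  have r_pred: "r (t - 1) \<le> r t - a" for t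
    using \<open>a \<le> b\<close> unfolding r_def by (simp add: min_def algebra_simps)
  obtain G where green: "green (\<lambda>n. A (Suc n)) G"
    and G_a: "\<And>m n. n \<le> m \<Longrightarrow>
      norm (G m n) \<le> D * exp (a * (real (Suc m) - real (Suc n)) + \<epsilon> * real (Suc n))"
    and G_b: "\<And>m n. m < n \<Longrightarrow>
      norm (G m n) \<le> D * exp (b * (real (Suc m) - real (Suc n)) + \<epsilon> * real (Suc n))"
    and G_diag: "\<And>n. norm (id_blinfun - G n n)
      \<le> D * exp (b * (real (Suc n) - real (Suc n)) + \<epsilon> * real (Suc n))"
    by (rule green_if_general_dichotomy[OF assms(3)], rule that)
  have G_le: "norm (G m n) \<le> D * exp (\<epsilon> * real (Suc n)) * exp (r (real m - real n))" for m n
  proof (cases "n \<le> m")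
    case True
    then show ?thesis
      using G_a[OF True] by (simp add: r_nonneg exp_add mult_ac)
  next
    case False
    then show ?thesis
      using G_b[of m n] by (simp add: r_nonpos exp_add mult_ac)
  qed
  define q where "q = exp (\<epsilon> - \<gamma>)"
  \<comment> \<open>Column \<open>Suc k\<close> of the shifted kernel has original index
    \<open>k + 2\<close>, and the bound on \<open>B (Suc k)\<close> has the same exponent, hence
    \<open>q ^ (k + 2)\<close>. The factor \<open>exp (- a)\<close> accounts for the step from
    \<open>k\<close> to \<open>Suc k\<close>. The sum over \<open>k\<close> is \<theta>.\<close>
  define c where "c k = D * \<delta> * exp (- a) * q ^ (k + 2)" for k
  have q: "0 < q" "q < 1"
    using assms(7) by (simp_all add: q_def)
  have q2: "exp (2 * \<epsilon> - 2 * \<gamma> - a) = exp (- a) * q ^ 2"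
    unfolding q_def exp_of_nat_mult[symmetric] mult_exp_exp by (simp add: algebra_simps)
  have "(\<lambda>k. D * \<delta> * exp (- a) * q ^ 2 * q ^ k) sums (D * \<delta> * exp (- a) * q ^ 2 * (1 / (1 - q)))"
    using q by (intro sums_mult geometric_sums) simp
  then have c_sums: "c sums \<theta>"
    unfolding assms(8) q2 q_def[symmetric]
    by (simp add: c_def[abs_def] power_add power2_eq_square mult_ac inverse_eq_divide)
  \<comment> \<open>Both kinds of weights are exponentials, so the kernel estimate reduces to an
    inequality between exponents.\<close>
  have kernel: "weighted_kernel (\<lambda>m k. G m (Suc k) o\<^sub>L B (Suc k)) (\<lambda>m. exp (f m)) c \<theta>"
    if f: "\<And>m k. r (real m - real (Suc k)) + f k \<le> f m - a" for f :: "nat \<Rightarrow> real"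
  proof
    fix m k
    have B_le: "norm (B (Suc k)) \<le> \<delta> * exp (- \<gamma> * (real k + 2))"
      using assms(5)[of "Suc k"] by (simp add: add.commute)
    have G_le': "norm (G m (Suc k)) \<le> D * exp (\<epsilon> * (real k + 2)) * exp (r (real m - real (Suc k)))"
      using G_le[of m "Suc k"] by (simp add: add.commute)
    have "norm (G m (Suc k) o\<^sub>L B (Suc k)) \<le>
        D * exp (\<epsilon> * (real k + 2)) * exp (r (real m - real (Suc k))) * (\<delta> * exp (- \<gamma> * (real k + 2)))"
      by (rule order_trans[OF norm_blinfun_compose mult_mono[OF G_le' B_le]]) (use assms(1) in simp_all)
    also have "\<dots> = D * \<delta> * (exp (\<epsilon> * (real k + 2)) * exp (- \<gamma> * (real k + 2)))
        * exp (r (real m - real (Suc k)))"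
      by (simp only: mult_ac)
    also have "exp (\<epsilon> * (real k + 2)) * exp (- \<gamma> * (real k + 2)) = q ^ (k + 2)"
      unfolding q_def exp_of_nat_mult[symmetric] mult_exp_exp by (simp add: algebra_simps)
    finally have "norm (G m (Suc k) o\<^sub>L B (Suc k)) * exp (f k)
        \<le> D * \<delta> * q ^ (k + 2) * exp (r (real m - real (Suc k))) * exp (f k)"
      by (rule mult_right_mono) simp
    also have "\<dots> = D * \<delta> * q ^ (k + 2) * exp (r (real m - real (Suc k)) + f k)"
      by (simp add: exp_add mult.assoc)
    also have "\<dots> \<le> D * \<delta> * q ^ (k + 2) * exp (f m - a)"
      using assms(1,4) q f by (intro mult_left_mono) auto
    also have "\<dots> = c k * exp (f m)"
      by (simp add: c_def exp_diff exp_minus field_simps)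
    finally show "norm (G m (Suc k) o\<^sub>L B (Suc k)) * exp (f k) \<le> c k * exp (f m)" .
  qed (use c_sums assms(9) in simp_all)
  obtain H where H: "green (\<lambda>n. A (Suc n) + B (Suc n)) H"
    and H_le: "\<And>m n. norm (H m n) \<le>
      D * exp (\<epsilon> * real (Suc n)) / (1 - \<theta>) * exp (r (real m - real n))"
    and H_diag: "\<And>n. norm (id_blinfun - H n n) \<le>
      D * exp (\<epsilon> * real (Suc n)) / (1 - \<theta>) * exp (r (real n - real n))"
  proof (rule green_perturbation[OF green, where w = "\<lambda>n m. exp (r (real m - real n))"
        and v = "\<lambda>m. exp (a * real m)" and L = "\<lambda>n. exp (- a * real n)"
        and B = "\<lambda>n. B (Suc n)" and C = "\<lambda>n. D * exp (\<epsilon> * real (Suc n))"])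
    show "weighted_kernel (\<lambda>m k. G m (Suc k) o\<^sub>L B (Suc k)) (\<lambda>m. exp (r (real m - real n))) c \<theta>" for n
    proof (rule kernel)
      fix m k
      \<comment> \<open>Superadditivity joins the two lags to \<open>m - n - 1\<close>;
        \<open>r_pred\<close> restores the missing step and leaves \<open>- a\<close>.\<close>
      show "r (real m - real (Suc k)) + r (real k - real n) \<le> r (real m - real n) - a"
        using r_add[of "real m - real (Suc k)" "real k - real n"] r_pred[of "real m - real n"]
        by (simp add: algebra_simps)
    qed
    \<comment> \<open>Replacing \<open>r\<close> by its linear majorant separates \<open>m\<close>
      from \<open>n\<close>, so one weight serves all columns up to the factor
      \<open>exp (- a * real n)\<close>.\<close>
    show "weighted_kernel (\<lambda>m k. G m (Suc k) o\<^sub>L B (Suc k)) (\<lambda>m. exp (a * real m)) c \<theta>"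
    proof (rule kernel)
      fix m k
      show "r (real m - real (Suc k)) + a * real k \<le> a * real m - a"
        using r_le[of "real m - real (Suc k)"] by (simp add: algebra_simps)
    qed
    show "exp (r (real m - real n)) \<le> exp (- a * real n) * exp (a * real m)" for m n
      using r_le[of "real m - real n"] by (simp add: mult_exp_exp algebra_simps)
    show "norm (id_blinfun - G n n) \<le> D * exp (\<epsilon> * real (Suc n)) * exp (r (real n - real n))" for n
      using G_diag[of n] by (simp add: r_def)
  qed (rule G_le, rule that)
  show ?thesis
  proof (rule general_dichotomy_if_green[OF H])
    fix m n :: nat
    show "norm (H m n) \<le> D / (1 - \<theta>) * exp (a * (real (Suc m) - real (Suc n)) + \<epsilon> * real (Suc n))"
      if "n \<le> m"
      using H_le[of m n] that by (simp add: r_nonneg exp_add mult_ac)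
    show "norm (H m n) \<le> D / (1 - \<theta>) * exp (b * (real (Suc m) - real (Suc n)) + \<epsilon> * real (Suc n))"
      if "m < n"
      using H_le[of m n] that by (simp add: r_nonpos exp_add mult_ac)
    show "norm (id_blinfun - H n n)
        \<le> D / (1 - \<theta>) * exp (b * (real (Suc n) - real (Suc n)) + \<epsilon> * real (Suc n))"
      using H_diag[of n] by (simp add: r_def)
  qed
qed

end
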